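(* Let $p$ be a prime and let $S\subseteq\mathbb{F}_p^3$ be a $p$-divisible set of size $p^2$, i.e. $|S|=p^2$ and $|S\cap H|\equiv 0\pmod p$ for every affine plane $H\subseteq\mathbb{F}_p^3$. Then $\mathbf{1}_S$ is a $\mathbb{Z}$-linear combination of characteristic functions of cylinders. Alternatively, $\mathbf{1}_S$ is the sum of the characteristic function of an affine plane and an element of $\operatorname{Span}_{\mathbb{Z}}\{\mathbf{1}_{\ell_1}-\mathbf{1}_{\ell_2} : \ell_1,\ell_2 \text{ affine lines in } \mathbb{F}_p^3,\ \ell_1\parallel\ell_2\}$.
   Context: Lines and planes are affine one- and two-dimensional subspaces of $\mathbb{F}_p^3$. For $X\subseteq\mathbb{F}_p^3$, $\mathbf{1}_X:\mathbb{F}_p^3\to\mathbb{Z}$ denotes its characteristic function. Write $\ell_1\parallel\ell_2$ if the lines $\ell_1,\ell_2$ are parallel. A cylinder is a subset of $\mathbb{F}_p^3$ that is the union of $p$ pairwise disjoint parallel lines. $\operatorname{Span}_{\mathbb{Z}}$ denotes the set of finite integer linear combinations. *)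

theory Defs
  imports "HOL-Analysis.Analysis" "HOL-Number_Theory.Cong"
begin

text \<open>
  The ground field is an arbitrary type \<open>'k\<close> of class \<open>field\<close> with \<open>CARD('k) = p\<close> prime, i.e. the
  field with \<open>p\<close> elements. \<open>HOL-Analysis\<close> has \<open>affine\<close> and \<open>aff_dim\<close> only over the reals, so
  affine subspaces are given here as translates of linear subspaces of \<open>'k ^ 'n\<close>.
\<close>

definition affine_flat :: "nat \<Rightarrow> ('k::field ^ 'n) set \<Rightarrow> bool" where
  "affine_flat d A \<longleftrightarrow> (\<exists>a V. vec.subspace V \<and> vec.dim V = d \<and> A = (+) a ` V)"

abbreviation is_line :: "('k::field ^ 3) set \<Rightarrow> bool" where
  "is_line \<equiv> affine_flat 1"

abbreviation is_plane :: "('k::field ^ 3) set \<Rightarrow> bool" where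
  "is_plane \<equiv> affine_flat 2"

text \<open>Parallel lines have the same direction space; every line is parallel to itself.\<close>

definition parallel_lines :: "('k::field ^ 3) set \<Rightarrow> ('k ^ 3) set \<Rightarrow> bool" where
  "parallel_lines l1 l2 \<longleftrightarrow>
     (\<exists>V a b. vec.subspace V \<and> vec.dim V = 1 \<and> l1 = (+) a ` V \<and> l2 = (+) b ` V)"

definition is_cylinder :: "('k::field ^ 3) set \<Rightarrow> bool" where
  "is_cylinder C \<longleftrightarrow>
     (\<exists>L. card L = CARD('k) \<and> (\<forall>l\<in>L. is_line l) \<and> pairwise disjnt L \<and>
          (\<forall>l1\<in>L. \<forall>l2\<in>L. parallel_lines l1 l2) \<and> C = \<Union>L)"

definition p_divisible :: "nat \<Rightarrow> ('k::field ^ 3) set \<Rightarrow> bool" where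
  "p_divisible p S \<longleftrightarrow> (\<forall>H. is_plane H \<longrightarrow> [card (S \<inter> H) = 0] (mod p))"

definition int_span :: "('a \<Rightarrow> int) set \<Rightarrow> ('a \<Rightarrow> int) set" where
  "int_span F = {f. \<exists>T c. finite T \<and> T \<subseteq> F \<and> f = (\<lambda>x. \<Sum>g\<in>T. c g * g x)}"

end

theory Submission
  imports Defs "HOL-Library.Function_Algebras"
begin

text \<open>
  Let \<open>M\<close> be the integer span of the differences of parallel lines. A pencil of lines in a plane
  through two points \<open>x\<close> and \<open>y\<close> shows that \<open>p (1\<^sub>x - 1\<^sub>y) \<in> M\<close>, so membership in \<open>M\<close> of a function with
  sum zero may be decided modulo \<open>p\<close>. Modulo \<open>p\<close>, the products \<open>(x + a z)\<^sup>i (y + b z)\<^sup>j\<close> lie in \<open>M\<close> unless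
  \<open>i = j = p - 1\<close>, and extracting the coefficients in \<open>a\<close> and \<open>b\<close> gives every reduced monomial of degree
  less than \<open>2 (p - 1)\<close>. On the other hand, \<open>p\<close>-divisibility says that \<open>(x + a y + b z + c)\<^sup>p\<^sup>-\<^sup>1\<close> sums to
  zero over \<open>S\<close> for all \<open>a, b, c\<close>, hence so does every monomial of degree less than \<open>p\<close>. The coefficients
  of the reduced polynomial of \<open>1\<^sub>S\<close> in degrees at least \<open>2 (p - 1)\<close> are combinations of such sums and vanish.
\<close>

subsection \<open>Finite prime fields\<close>

lemma finite_prime_CARD: "prime CARD('k) \<Longrightarrow> finite (UNIV :: 'k set)"
  by (rule ccontr) simp

text \<open>Translation by 1 permutes the field and so preserves the sum of all its elements;
  comparing the two sums leaves \<open>CARD('k)\<close> ones adding up to zero.\<close>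

lemma of_nat_CARD_eq_0:
  assumes "finite (UNIV :: 'k::field set)"
  shows "(of_nat CARD('k) :: 'k) = 0"
proof -
  have "bij ((+) (1::'k))" by (rule bij_plus)
  then have "(\<Sum>x\<in>UNIV. 1 + x) = (\<Sum>x\<in>UNIV. x :: 'k)"
    by (rule sum.reindex_bij_betw)
  then have "(\<Sum>x\<in>(UNIV::'k set). 1::'k) = 0"
    unfolding sum.distrib by simp
  then show ?thesis by simp
qed

lemma of_nat_CARD_prime: "prime CARD('k::field) \<Longrightarrow> (of_nat CARD('k) :: 'k) = 0"
  by (intro of_nat_CARD_eq_0 finite_prime_CARD)

lemma of_int_eq_0_iff_prime_CARD:
  assumes "prime CARD('k::field)"
  shows "(of_int z :: 'k) = 0 \<longleftrightarrow> int CARD('k) dvd z"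
proof -
  have "CHAR('k) dvd CARD('k)"
    using of_nat_CARD_prime[OF assms] by (simp add: of_nat_eq_0_iff_char_dvd)
  then have "CHAR('k) = CARD('k)"
    using assms by (metis CHAR_not_1' One_nat_def prime_nat_iff)
  then show ?thesis by (simp add: of_int_eq_0_iff_char_dvd)
qed

text \<open>The numbers below p have distinct residues, hence these exhaust the field. This allows
  field scalars to be lifted to integers.\<close>

lemma of_int_surj_prime_CARD:
  assumes "prime CARD('k::field)"
  shows "\<exists>z. of_int z = (x::'k)"
proof -
  have "inj_on (of_nat :: nat \<Rightarrow> 'k) {..<CARD('k)}"
  proof (rule inj_onI)
    fix m n assume mn: "m \<in> {..<CARD('k)}" "n \<in> {..<CARD('k)}" "(of_nat m :: 'k) = of_nat n"
    then have "(of_int (int m - int n) :: 'k) = 0" by simp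
    then have "int CARD('k) dvd int m - int n"
      using of_int_eq_0_iff_prime_CARD[OF assms] by blast
    then show "m = n" using mn
      by (smt (verit) lessThan_iff mod_eq_dvd_iff mod_less of_nat_eq_iff of_nat_mod)
  qed
  then have "of_nat ` {..<CARD('k)} = (UNIV :: 'k set)"
    by (intro card_subset_eq finite_prime_CARD assms) (simp_all add: card_image)
  then have "x \<in> of_nat ` {..<CARD('k)}" by simp
  then obtain n where "x = of_nat n" by blast
  then show ?thesis by (intro exI[of _ "int n"]) simp
qed

text \<open>Fermat's little theorem: multiplication by \<open>x\<close> permutes the nonzero
  elements, so their product does not change when each factor is multiplied by
  \<open>x\<close>.\<close>

lemma power_CARD_minus_1:
  assumes "prime CARD('k::field)" "(x::'k) \<noteq> 0"
  shows "x ^ (CARD('k) - 1) = 1"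
proof -
  have fin: "finite (UNIV - {0::'k})" using finite_prime_CARD[OF assms(1)] by simp
  have "bij_betw ((*) x) (UNIV - {0}) (UNIV - {0})"
    by (rule bij_betwI[of _ _ _ "\<lambda>y. y / x"]) (use assms in auto)
  then have "(\<Prod>y\<in>UNIV - {0}. x * y) = \<Prod>(UNIV - {0})"
    by (rule prod.reindex_bij_betw)
  then have "x ^ card (UNIV - {0::'k}) * \<Prod>(UNIV - {0}) = 1 * \<Prod>(UNIV - {0})"
    by (simp add: prod.distrib)
  moreover have "\<Prod>(UNIV - {0::'k}) \<noteq> 0" using fin by simp
  ultimately show ?thesis by (simp add: card_Diff_singleton)
qed

lemma indicator_eq_power:
  assumes "prime CARD('k::field)"
  shows "(if x = 0 then 1 else 0) = 1 - (x::'k) ^ (CARD('k) - 1)"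
  using power_CARD_minus_1[OF assms, of x] prime_gt_1_nat[OF assms] by (simp add: power_0_left)

section \<open>Power sums over the field\<close>

lemma sum_power_CARD_minus_1:
  assumes "prime CARD('k::field)"
  shows "(\<Sum>x\<in>UNIV. (x::'k) ^ (CARD('k) - 1)) = -1"
proof -
  have "(\<Sum>x\<in>UNIV. 1 - (x::'k) ^ (CARD('k) - 1)) = (\<Sum>x\<in>UNIV. if x = (0::'k) then 1 else 0)"
    by (simp only: indicator_eq_power[OF assms])
  also have "\<dots> = 1" using finite_prime_CARD[OF assms] by simp
  finally show ?thesis
    using of_nat_CARD_prime[OF assms] by (simp add: sum_subtractf algebra_simps minus_equation_iff)
qed

text \<open>Replacing \<open>x\<close> by \<open>c * x\<close> permutes the field and multiplies the
  sum by \<open>c ^ i\<close>. Some nonzero \<open>c\<close> has \<open>c ^ i \<noteq> 1\<close>,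
  since X^r - 1 has at most r < p - 1 roots, where r is the residue of \<open>i\<close> modulo p -
  1.\<close>

lemma sum_power_eq_0:
  assumes p: "prime CARD('k::field)" and "\<not> (CARD('k) - 1) dvd i"
  shows "(\<Sum>x\<in>UNIV. (x::'k) ^ i) = 0"
proof -
  have fin: "finite (UNIV :: 'k set)" by (rule finite_prime_CARD[OF p])
  define r where "r = i mod (CARD('k) - 1)"
  have r: "0 < r" "r < CARD('k) - 1"
    using assms(2) prime_gt_1_nat[OF p] by (auto simp: r_def mod_greater_zero_iff_not_dvd)
  have pow: "c ^ i = c ^ r" if "c \<noteq> 0" for c :: 'k
  proof -
    have "c ^ i = (c ^ (CARD('k) - 1)) ^ (i div (CARD('k) - 1)) * c ^ r"
      unfolding r_def by (simp flip: power_mult power_add)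
    then show ?thesis by (simp only: power_CARD_minus_1[OF p that] power_one mult_1)
  qed
  have "\<exists>c::'k. c \<noteq> 0 \<and> c ^ r \<noteq> 1"
  proof (rule ccontr)
    assume "\<not> ?thesis"
    then have sub: "UNIV - {0::'k} \<subseteq> {c. poly (monom 1 r - 1) c = 0}"
      by (auto simp: poly_monom)
    have ne: "(monom 1 r - 1 :: 'k poly) \<noteq> 0"
      using r by (metis (no_types) coeff_monom degree_1 degree_monom_eq eq_iff_diff_eq_0 less_irrefl one_neq_zero)
    have "CARD('k) - 1 \<le> card {c::'k. poly (monom 1 r - 1) c = 0}"
      using card_mono[OF finite_subset[OF subset_UNIV fin] sub] fin by (simp add: card_Diff_singleton)
    also have "\<dots> \<le> degree (monom 1 r - 1 :: 'k poly)"
      by (rule card_poly_roots_bound[OF ne])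
    also have "\<dots> \<le> r" by (intro degree_diff_le degree_monom_le) simp
    finally show False using r by simp
  qed
  then obtain c :: 'k where c: "c \<noteq> 0" "c ^ r \<noteq> 1" by blast
  have "bij ((*) c)"
    by (rule bij_betwI[of _ _ _ "\<lambda>y. y / c"]) (use c in auto)
  then have "(\<Sum>x\<in>UNIV. (c * x) ^ i) = (\<Sum>x\<in>UNIV. x ^ i)"
    by (rule sum.reindex_bij_betw)
  then have "c ^ r * (\<Sum>x\<in>UNIV. x ^ i) = (\<Sum>x\<in>UNIV. x ^ i)"
    using c by (simp add: power_mult_distrib sum_distrib_left pow)
  then show ?thesis using c by simp
qed

lemma sum_power_less_eq_0:
  assumes "prime CARD('k::field)" "i < CARD('k) - 1"
  shows "(\<Sum>x\<in>UNIV. (x::'k) ^ i) = 0"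
proof (cases "i = 0")
  case False
  then have "\<not> (CARD('k) - 1) dvd i" using assms(2) by (meson dvd_imp_le not_le not_gr0)
  then show ?thesis by (rule sum_power_eq_0[OF assms(1)])
qed (simp add: of_nat_CARD_prime[OF assms(1)])

text \<open>The binomial coefficient divides \<open>fact m\<close>, which is prime to p because
  \<open>m\<close> is below p.\<close>

lemma binomial_neq_0_prime_CARD:
  assumes "prime CARD('k::field)" "m < CARD('k)" "r \<le> m"
  shows "(of_nat (m choose r) :: 'k) \<noteq> 0"
proof
  assume "(of_nat (m choose r) :: 'k) = 0"
  then have "CARD('k) dvd m choose r"
    using of_int_eq_0_iff_prime_CARD[OF assms(1), of "int (m choose r)"] by simp
  then have "CARD('k) dvd fact m"
    using binomial_fact_lemma[OF assms(3)] by (metis dvd_mult)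
  then show False using prime_dvd_fact_iff[OF assms(1)] assms(2) by simp
qed

subsection \<open>Modules of functions\<close>

text \<open>The scalars form any commutative ring, so that the same span and subspace notions serve
  integer-valued and field-valued functions.\<close>

interpretation fn: Modules.module "\<lambda>(c::'a::comm_ring_1) (f::'b \<Rightarrow> 'a) x. c * f x"
  by unfold_locales (auto simp: algebra_simps fun_eq_iff)

lemma sum_fun_apply: "(\<Sum>i\<in>A. f i) x = (\<Sum>i\<in>A. f i x)"
  for f :: "'i \<Rightarrow> 'b \<Rightarrow> 'a::comm_monoid_add"
  by (induction A rule: infinite_finite_induct) auto

lemma int_span_eq_span: "int_span F = fn.span F"
  unfolding int_span_def fn.span_explicit by (auto simp: fun_eq_iff sum_fun_apply)

text \<open>Coefficient extraction in the parameter \<open>a\<close>: summing over all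
  \<open>a\<close> with weight \<open>a ^ (p - 1 - r)\<close> turns the term in \<open>a ^ k\<close>
  into a power sum, which vanishes except for \<open>k = r\<close>.\<close>

lemma subspace_binomial_coeff:
  fixes A B g :: "'b \<Rightarrow> 'k::field"
  assumes p: "prime CARD('k)" and V: "fn.subspace V" and m: "m < CARD('k)" and "r \<le> m"
    and mem: "\<And>a. (\<lambda>u. g u * (A u + a * B u) ^ m) \<in> V"
  shows "(\<lambda>u. g u * (A u ^ (m - r) * B u ^ r)) \<in> V"
proof (cases "r = 0")
  case True
  \<comment> \<open>For \<open>r = 0\<close> the weighted sum could also pick up the term
    \<open>k = p - 1\<close>; setting \<open>a = 0\<close> isolates the constant term
    instead.\<close>
  then show ?thesis using mem[of 0] by simp
next
  case False
  let ?q = "CARD('k) - 1"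
  have fin: "finite (UNIV :: 'k set)" by (rule finite_prime_CARD[OF p])
  have *: "(\<Sum>a\<in>UNIV. a ^ (?q - r) * (g u * (A u + a * B u) ^ m))
      = - of_nat (m choose r) * (g u * (A u ^ (m - r) * B u ^ r))" for u
  proof -
    have "(\<Sum>a\<in>UNIV. a ^ (?q - r) * (g u * (A u + a * B u) ^ m))
        = (\<Sum>a\<in>UNIV. \<Sum>k\<le>m. (of_nat (m choose k) * (g u * (A u ^ (m - k) * B u ^ k))) * a ^ (?q - r + k))"
      unfolding add.commute[of "A u"] binomial_ring sum_distrib_left
      by (simp add: power_add power_mult_distrib mult_ac)
    also have "\<dots> = (\<Sum>k\<le>m. (of_nat (m choose k) * (g u * (A u ^ (m - k) * B u ^ k))) * (\<Sum>a\<in>UNIV. a ^ (?q - r + k)))"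
      by (subst sum.swap) (simp add: sum_distrib_left)
    also have "\<dots> = (\<Sum>k\<le>m. if k = r then - of_nat (m choose r) * (g u * (A u ^ (m - r) * B u ^ r)) else 0)"
    proof (rule sum.cong)
      fix k assume "k \<in> {..m}"
      then have k: "k \<le> m" by simp
      show "(of_nat (m choose k) * (g u * (A u ^ (m - k) * B u ^ k))) * (\<Sum>a\<in>UNIV. a ^ (?q - r + k))
          = (if k = r then - of_nat (m choose r) * (g u * (A u ^ (m - r) * B u ^ r)) else 0)"
      proof (cases "k = r")
        case True
        then have "?q - r + k = ?q" using \<open>r \<le> m\<close> m by simp
        then show ?thesis using True sum_power_CARD_minus_1[OF p] by simp
      next
        case False
        \<comment> \<open>Since \<open>r > 0\<close>, the exponent is below 2 (p - 1), so a positive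
          multiple of p - 1 forces \<open>k = r\<close>. The exponent 0 occurs for
          \<open>r = p - 1\<close> and \<open>k = 0\<close>; then p ones sum to zero.\<close>
        have "\<not> ?q dvd ?q - r + k \<or> ?q - r + k = 0"
        proof (rule ccontr)
          assume "\<not> ?thesis"
          then have "?q dvd ?q - r + k" and pos: "?q - r + k > 0" by blast+
          from this(1) obtain t where t: "?q - r + k = ?q * t" by (elim dvdE)
          have "?q - r + k < ?q * 2" using k m \<open>r \<noteq> 0\<close> \<open>r \<le> m\<close> by linarith
          with t pos have "t < 2" "t > 0" by auto
          then have "t = 1" by simp
          with t False m \<open>r \<le> m\<close> show False by simp
        qed
        then have "(\<Sum>a\<in>UNIV. (a::'k) ^ (?q - r + k)) = 0"
          using sum_power_eq_0[OF p] of_nat_CARD_prime[OF p] by fastforce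
        then show ?thesis using False by simp
      qed
    qed simp
    also have "\<dots> = - of_nat (m choose r) * (g u * (A u ^ (m - r) * B u ^ r))"
      using \<open>r \<le> m\<close> by simp
    finally show ?thesis .
  qed
  have "(\<Sum>a\<in>UNIV. (\<lambda>u. a ^ (?q - r) * (g u * (A u + a * B u) ^ m))) \<in> V"
    by (intro fn.subspace_sum fn.subspace_scale V mem)
  also have "(\<Sum>a\<in>UNIV. (\<lambda>u. a ^ (?q - r) * (g u * (A u + a * B u) ^ m)))
      = (\<lambda>u. - of_nat (m choose r) * (g u * (A u ^ (m - r) * B u ^ r)))"
    by (rule ext) (simp only: sum_fun_apply *)
  finally have "(\<lambda>u. - inverse (of_nat (m choose r)) * (- of_nat (m choose r) * (g u * (A u ^ (m - r) * B u ^ r)))) \<in> V"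
    by (rule fn.subspace_scale[OF V])
  then show ?thesis
    using binomial_neq_0_prime_CARD[OF p m \<open>r \<le> m\<close>] by (simp add: mult.assoc[symmetric])
qed

subsection \<open>Lines and planes\<close>

definition line :: "'k::field ^ 'n \<Rightarrow> 'k ^ 'n \<Rightarrow> ('k ^ 'n) set" where
  "line x v = range (\<lambda>c. x + c *s v)"

lemma line_eq_translate: "line x v = (+) x ` range (\<lambda>c. c *s v)"
  by (auto simp: line_def)

lemma subspace_range_smult: "vec.subspace (range (\<lambda>c. c *s v))"
  using vec.subspace_span[of "{v}"] by (simp add: vec.span_singleton)

lemma dim_range_smult: "v \<noteq> 0 \<Longrightarrow> vec.dim (range (\<lambda>c. c *s v)) = 1"
  using vec.dim_span[of "{v}"] vec.dim_eq_card_independent[of "{v}"]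
  by (simp add: vec.span_singleton)

lemma is_line_line: "v \<noteq> 0 \<Longrightarrow> is_line (line x v)"
  unfolding affine_flat_def line_eq_translate
  using subspace_range_smult dim_range_smult by blast

text \<open>Replaces direction spaces by direction vectors: a one-dimensional space consists of the
  multiples of a basis vector.\<close>

lemma parallel_lines_iff:
  "parallel_lines l1 l2 \<longleftrightarrow> (\<exists>v a b. v \<noteq> 0 \<and> l1 = line a v \<and> l2 = line b v)"
proof
  assume "parallel_lines l1 l2"
  then obtain V a b where V: "vec.subspace V" "vec.dim V = 1" "l1 = (+) a ` V" "l2 = (+) b ` V"
    unfolding parallel_lines_def by blast
  obtain B where B: "B \<subseteq> V" "vec.independent B" "V \<subseteq> vec.span B" "card B = 1"
    using vec.basis_exists[of V] V(2) by metis
  then obtain v where v: "B = {v}" by (auto simp: card_1_singleton_iff)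
  have "V = range (\<lambda>c. c *s v)"
    using B v V(1) vec.span_minimal[of B V] by (auto simp: vec.span_singleton)
  moreover have "v \<noteq> 0" using B(2) v by auto
  ultimately show "\<exists>v a b. v \<noteq> 0 \<and> l1 = line a v \<and> l2 = line b v"
    using V by (auto simp: line_eq_translate)
next
  assume "\<exists>v a b. v \<noteq> 0 \<and> l1 = line a v \<and> l2 = line b v"
  then show "parallel_lines l1 l2"
    unfolding parallel_lines_def line_eq_translate
    using subspace_range_smult dim_range_smult by blast
qed

lemma card_line:
  assumes "v \<noteq> (0 :: 'k::field ^ 'n)"
  shows "card (line x v) = CARD('k)"
  unfolding line_def by (rule card_image) (auto intro!: injI simp: assms)

lemma line_disjoint_or_eq: "line x v = line y v \<or> disjnt (line x v) (line y v)"
proof (cases "\<exists>z. z \<in> line x v \<and> z \<in> line y v")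
  case True
  then obtain c d where cd: "x + c *s v = y + d *s v" by (auto simp: line_def)
  then have x: "x = y + (d - c) *s v" by (simp add: vec.scale_left_diff_distrib algebra_simps)
  have "x + e *s v = y + (d - c + e) *s v" "y + e *s v = x + (c - d + e) *s v" for e
    unfolding x by (simp_all add: vec.scale_left_distrib vec.scale_left_diff_distrib)
  then show ?thesis unfolding line_def by blast
qed (auto simp: disjnt_iff)

lemma mem_line_self: "x \<in> line x v"
  unfolding line_def by (rule image_eqI[of _ _ 0]) auto

lemma finite_UNIV_vec: "finite (UNIV :: 'k set) \<Longrightarrow> finite (UNIV :: ('k ^ 'n) set)"
  by (rule card_ge_0_finite) (simp add: card_gt_0_iff)

lemma vec3_eq_iff: "u = v \<longleftrightarrow> u$1 = v$1 \<and> u$2 = v$2 \<and> u$3 = (v$3 :: 'k)" for u v :: "'k ^ 3"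
  by (simp add: vec_eq_iff forall_3)

text \<open>The planes whose normal vector has first coordinate 1 supply the polynomials from which
  the monomial sums are extracted later.\<close>

lemma is_plane_equation: "is_plane {x :: 'k::field ^ 3. x$1 + a * x$2 + b * x$3 + c = 0}"
proof -
  let ?v = "vector [-a, 1, 0] :: 'k ^ 3" and ?w = "vector [-b, 0, 1] :: 'k ^ 3"
  have "?w \<notin> range (\<lambda>c. c *s ?v)" by (auto simp: vec3_eq_iff)
  moreover have "?v \<noteq> 0" by (simp add: vec3_eq_iff)
  ultimately have "vec.independent {?w, ?v}"
    by (subst vec.independent_insert) (simp add: vec.span_singleton)
  moreover have "?w \<noteq> ?v" by (simp add: vec3_eq_iff)
  ultimately have "vec.dim (vec.span {?w, ?v}) = 2"
    by (simp add: vec.dim_eq_card_independent)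
  moreover have "{x :: 'k ^ 3. x$1 + a * x$2 + b * x$3 + c = 0} = (+) (vector [-c, 0, 0]) ` vec.span {?w, ?v}"
  proof (intro equalityI subsetI)
    fix x :: "'k ^ 3" assume "x \<in> {x. x$1 + a * x$2 + b * x$3 + c = 0}"
    then have "x = vector [-c, 0, 0] + (x$3 *s ?w + x$2 *s ?v)"
      by (simp add: vec3_eq_iff algebra_simps eq_neg_iff_add_eq_0)
    moreover have "x$3 *s ?w + x$2 *s ?v \<in> vec.span {?w, ?v}"
      by (intro vec.span_add vec.span_scale vec.span_base) auto
    ultimately show "x \<in> (+) (vector [-c, 0, 0]) ` vec.span {?w, ?v}" by blast
  next
    fix x :: "'k ^ 3" assume "x \<in> (+) (vector [-c, 0, 0]) ` vec.span {?w, ?v}"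
    then obtain s t where "x = vector [-c, 0, 0] + (s *s ?w + t *s ?v)"
      by (force simp: vec.span_insert vec.span_singleton algebra_simps eq_diff_eq)
    then show "x \<in> {x. x$1 + a * x$2 + b * x$3 + c = 0}" by (simp add: algebra_simps)
  qed
  ultimately show ?thesis unfolding affine_flat_def using vec.subspace_span by blast
qed

subsection \<open>Differences of parallel lines\<close>

definition line_diffs :: "('k::field ^ 3 \<Rightarrow> int) set" where
  "line_diffs = {(\<lambda>x. indicator l1 x - indicator l2 x) | l1 l2.
     is_line l1 \<and> is_line l2 \<and> parallel_lines l1 l2}"

lemma line_diffs_eq:
  "line_diffs = {(\<lambda>z. indicator (line x v) z - indicator (line y v) z) | x y v. v \<noteq> 0}"
proof (intro equalityI subsetI)
  fix f :: "'a ^ 3 \<Rightarrow> int" assume "f \<in> line_diffs"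
  then obtain l1 l2 where "f = (\<lambda>x. indicator l1 x - indicator l2 x)" "parallel_lines l1 l2"
    unfolding line_diffs_def by blast
  then show "f \<in> {(\<lambda>z. indicator (line x v) z - indicator (line y v) z) | x y v. v \<noteq> 0}"
    unfolding parallel_lines_iff by blast
next
  fix f :: "'a ^ 3 \<Rightarrow> int"
  assume "f \<in> {(\<lambda>z. indicator (line x v) z - indicator (line y v) z) | x y v. v \<noteq> 0}"
  then obtain x y v where "f = (\<lambda>z. indicator (line x v) z - indicator (line y v) z)" "v \<noteq> 0"
    by blast
  then show "f \<in> line_diffs"
    unfolding line_diffs_def parallel_lines_iff
    using is_line_line[of v x] is_line_line[of v y] by blast
qed

lemma line_diff_mem_span:
  "v \<noteq> 0 \<Longrightarrow> (\<lambda>z. indicator (line x v) z - indicator (line y v) z) \<in> fn.span line_diffs"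
  by (rule fn.span_base) (auto simp: line_diffs_eq)

lemma sum_UNIV_indicator:
  "finite (UNIV :: 'a set) \<Longrightarrow> (\<Sum>z\<in>UNIV. indicator A z) = (of_nat (card (A :: 'a set)) :: 'b::semiring_1)"
  by (simp add: indicator_def sum.If_cases)

text \<open>Parallel lines have equally many points, so the total sum vanishes on every
  generator.\<close>

lemma sum_line_diff_span:
  assumes fin: "finite (UNIV :: 'k::field set)" and "f \<in> fn.span (line_diffs :: ('k ^ 3 \<Rightarrow> int) set)"
  shows "(\<Sum>z\<in>UNIV. f z) = 0"
  using assms(2)
proof (induction rule: fn.span_induct_alt)
  case (step c f g)
  have "finite (UNIV :: ('k ^ 3) set)" using fin by (rule finite_UNIV_vec)
  then have "(\<Sum>z\<in>UNIV. indicator (line x v) z - indicator (line y v) z :: int) = 0"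
    if "v \<noteq> 0" for x y v :: "'k ^ 3"
    using that by (simp add: sum_subtractf sum_UNIV_indicator card_line)
  then show ?case using step by (auto simp: sum.distrib line_diffs_eq simp flip: sum_distrib_left)
qed simp

section \<open>Pencils of lines and differences of points\<close>

text \<open>The p + 1 lines through \<open>x\<close> in a plane cover every other point of the plane
  once and \<open>x\<close> itself p + 1 times. Their directions are \<open>u + a *s w\<close> for
  all \<open>a\<close>, and \<open>w\<close>.\<close>

lemma pencil_of_lines:
  fixes x u w :: "'k::field ^ 3"
  assumes fin: "finite (UNIV :: 'k set)"
    and ind: "\<And>c d c' d'. c *s u + d *s w = c' *s u + d' *s w \<Longrightarrow> c = c' \<and> d = d'"
  shows "(\<Sum>a\<in>UNIV. indicator (line x (u + a *s w)) z) + indicator (line x w) z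
    = (indicator {x + (s *s u + t *s w) | s t. True} z + int CARD('k) * indicator {x} z)"
proof (cases "\<exists>s t. z = x + (s *s u + t *s w)")
  case False
  have "z \<notin> line x (u + a *s w)" for a
  proof
    assume "z \<in> line x (u + a *s w)"
    then obtain c where "z = x + c *s (u + a *s w)" unfolding line_def by blast
    then have "z = x + (c *s u + (c * a) *s w)" by (simp add: vec.scale_right_distrib)
    then show False using False by blast
  qed
  moreover have "z \<notin> line x w"
  proof
    assume "z \<in> line x w"
    then obtain c where "z = x + c *s w" unfolding line_def by blast
    then have "z = x + (0 *s u + c *s w)" by simp
    then show False using False by blast
  qed
  moreover have "z \<noteq> x"
  proof
    assume "z = x"
    then have "z = x + (0 *s u + 0 *s w)" by simp
    then show False using False by blast
  qed
  ultimately show ?thesis using False by (auto simp: indicator_def)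
next
  case True
  then obtain s t where z: "z = x + (s *s u + t *s w)" by blast
  have zx: "z = x \<longleftrightarrow> s = 0 \<and> t = 0"
    using ind[of s t 0 0] by (auto simp: z)
  have zw: "z \<in> line x w \<longleftrightarrow> s = 0"
  proof
    assume "z \<in> line x w"
    then obtain c where "z = x + c *s w" unfolding line_def by blast
    then have "s *s u + t *s w = 0 *s u + c *s w" by (simp add: z)
    then show "s = 0" using ind by blast
  next
    assume "s = 0"
    then have "z = x + t *s w" by (simp add: z)
    then show "z \<in> line x w" unfolding line_def by blast
  qed
  have zl: "z \<in> line x (u + a *s w) \<longleftrightarrow> t = s * a" for a
  proof -
    have "z \<in> line x (u + a *s w) \<longleftrightarrow> (\<exists>c. s *s u + t *s w = c *s u + (c * a) *s w)"
      unfolding line_def by (auto simp: z vec.scale_right_distrib)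
    also have "\<dots> \<longleftrightarrow> t = s * a" using ind by blast
    finally show ?thesis .
  qed
  have "(\<Sum>a\<in>UNIV. indicator (line x (u + a *s w)) z) = (\<Sum>a\<in>UNIV. of_bool (t = s * a) :: int)"
    by (simp add: indicator_def zl)
  \<comment> \<open>The centre lies on all p lines with direction \<open>u + a *s w\<close>, the
    other points of \<open>line x w\<close> on none, and each remaining point on the one with
    \<open>a = t / s\<close>.\<close>
  also have "\<dots> = (if s = 0 then if t = 0 then int CARD('k) else 0 else 1)"
  proof (cases "s = 0")
    case False
    then have "t = s * a \<longleftrightarrow> a = t / s" for a by (auto simp: field_simps)
    with False show ?thesis using fin by (simp add: of_bool_def)
  qed simp
  finally show ?thesis using True by (auto simp: indicator_def zx zw)
qed

text \<open>In a plane through both points, the pencils at \<open>x\<close> and \<open>y\<close> are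
  subtracted direction by direction. The lines pair up into parallel ones, the plane cancels, and p
  times the difference of the centres remains.\<close>

lemma point_diff_mem_span:
  fixes x y :: "'k::field ^ 3"
  assumes fin: "finite (UNIV :: 'k set)"
  shows "(\<lambda>z. int CARD('k) * (indicator {x} z - indicator {y} z)) \<in> fn.span line_diffs"
proof (cases "x = y")
  case True
  then show ?thesis using fn.span_zero by (simp add: zero_fun_def)
next
  case False
  define u where "u = y - x"
  have "u \<noteq> 0" using False by (simp add: u_def)
  then obtain i where i: "u $ i \<noteq> 0" by (auto simp: vec_eq_iff)
  have "\<exists>j::3. j \<noteq> i" by (cases "i = 1") (auto intro: exI[of _ 2])
  then obtain j where j: "j \<noteq> i" by blast
  \<comment> \<open>Coordinate \<open>i\<close> of \<open>w\<close> is zero while that of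
    \<open>u\<close> is not, so \<open>u\<close> and \<open>w\<close> are independent.\<close>
  define w :: "'k ^ 3" where "w = axis j 1"
  have ind: "c = c' \<and> d = d'" if "c *s u + d *s w = c' *s u + d' *s w" for c d c' d'
  proof -
    have "(c *s u + d *s w) $ i = (c' *s u + d' *s w) $ i" "(c *s u + d *s w) $ j = (c' *s u + d' *s w) $ j"
      using that by simp_all
    then show ?thesis using i j by (simp add: w_def axis_def)
  qed
  have nz: "u + a *s w \<noteq> 0" "w \<noteq> 0" for a
    using ind[of 1 a 0 0] ind[of 0 1 0 0] by auto
  have plane: "{x + (s *s u + t *s w) | s t. True} = {y + (s *s u + t *s w) | s t. True}"
  proof -
    have "x + (s *s u + t *s w) = y + ((s - 1) *s u + t *s w)"
         "y + (s *s u + t *s w) = x + ((s + 1) *s u + t *s w)" for s t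
      by (simp_all add: u_def vec.scale_left_distrib vec.scale_left_diff_distrib)
    then show ?thesis by blast
  qed
  have "(\<Sum>a\<in>UNIV. (\<lambda>z. indicator (line x (u + a *s w)) z - indicator (line y (u + a *s w)) z))
      + (\<lambda>z. indicator (line x w) z - indicator (line y w) z) \<in> fn.span line_diffs"
    by (intro fn.span_add fn.span_sum line_diff_mem_span nz)
  also have "(\<Sum>a\<in>UNIV. (\<lambda>z. indicator (line x (u + a *s w)) z - indicator (line y (u + a *s w)) z))
      + (\<lambda>z. indicator (line x w) z - indicator (line y w) z)
      = (\<lambda>z. int CARD('k) * (indicator {x} z - indicator {y} z))"
  proof
    fix z
    show "((\<Sum>a\<in>UNIV. (\<lambda>z. indicator (line x (u + a *s w)) z - indicator (line y (u + a *s w)) z))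
      + (\<lambda>z. indicator (line x w) z - indicator (line y w) z)) z
      = int CARD('k) * (indicator {x} z - indicator {y} z)"
      using pencil_of_lines[where x = x and u = u and w = w and z = z, OF fin ind]
        pencil_of_lines[where x = y and u = u and w = w and z = z, OF fin ind]
      unfolding plane by (simp add: sum_fun_apply sum_subtractf algebra_simps)
  qed
  finally show ?thesis .
qed

text \<open>A function with sum zero is the combination of the differences between each point and
  the origin, with its own values as coefficients.\<close>

lemma CARD_multiple_mem_span:
  fixes g :: "'k::field ^ 3 \<Rightarrow> int"
  assumes fin: "finite (UNIV :: 'k set)" and g: "(\<Sum>z\<in>UNIV. g z) = 0"
  shows "(\<lambda>z. int CARD('k) * g z) \<in> fn.span line_diffs"
proof -
  have fin3: "finite (UNIV :: ('k ^ 3) set)" using fin by (rule finite_UNIV_vec)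
  have "(\<Sum>x\<in>UNIV. (\<lambda>z. g x * (int CARD('k) * (indicator {x} z - indicator {0} z)))) \<in> fn.span line_diffs"
    by (intro fn.span_sum fn.span_scale point_diff_mem_span fin)
  also have "(\<Sum>x\<in>UNIV. (\<lambda>z. g x * (int CARD('k) * (indicator {x} z - indicator {0} z))))
      = (\<lambda>z. int CARD('k) * g z)"
  proof
    fix z
    have "(\<Sum>x\<in>UNIV. g x * (indicator {x} z - indicator {0} z))
        = (\<Sum>x\<in>UNIV. g x * indicator {x} z) - (\<Sum>x\<in>UNIV. g x) * indicator {0} z"
      by (simp add: algebra_simps sum_subtractf sum_distrib_right)
    also have "\<dots> = g z" using fin3 by (simp add: g indicator_def if_distrib cong: if_cong)
    finally have "int CARD('k) * (\<Sum>x\<in>UNIV. g x * (indicator {x} z - indicator {0} z)) = int CARD('k) * g z"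
      by (rule arg_cong)
    then show "(\<Sum>x\<in>UNIV. (\<lambda>z. g x * (int CARD('k) * (indicator {x} z - indicator {0} z)))) z
      = int CARD('k) * g z"
      unfolding sum_fun_apply sum_distrib_left by (simp only: mult.left_commute)
  qed
  finally show ?thesis .
qed

subsection \<open>Reduction modulo the characteristic\<close>

definition reduced_line_diffs :: "('k::field ^ 3 \<Rightarrow> 'k) set" where
  "reduced_line_diffs = {(\<lambda>u. of_int (f u)) | f. f \<in> fn.span line_diffs}"

lemma reduced_line_diffsI: "f \<in> fn.span line_diffs \<Longrightarrow> (\<lambda>u. of_int (f u)) \<in> reduced_line_diffs"
  unfolding reduced_line_diffs_def by blast

text \<open>The integer span stays closed under field scalars after reduction because every scalar
  is the residue of an integer.\<close>

lemma subspace_reduced_line_diffs: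
  assumes p: "prime CARD('k::field)"
  shows "fn.subspace (reduced_line_diffs :: ('k ^ 3 \<Rightarrow> 'k) set)"
proof (rule fn.subspaceI)
  have "(0 :: 'k ^ 3 \<Rightarrow> 'k) = (\<lambda>u. of_int ((0 :: 'k ^ 3 \<Rightarrow> int) u))" by (simp add: fun_eq_iff)
  then show "(0 :: 'k ^ 3 \<Rightarrow> 'k) \<in> reduced_line_diffs"
    unfolding reduced_line_diffs_def using fn.span_zero by blast
next
  fix g h :: "'k ^ 3 \<Rightarrow> 'k" assume "g \<in> reduced_line_diffs" "h \<in> reduced_line_diffs"
  then obtain f f' where f: "f \<in> fn.span line_diffs" "f' \<in> fn.span line_diffs"
      "g = (\<lambda>u. of_int (f u))" "h = (\<lambda>u. of_int (f' u))"
    unfolding reduced_line_diffs_def by blast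
  have "g + h = (\<lambda>u. of_int ((f + f') u))" by (simp add: f fun_eq_iff)
  then show "g + h \<in> reduced_line_diffs"
    unfolding reduced_line_diffs_def using fn.span_add[OF f(1,2)] by blast
next
  fix c :: 'k and g :: "'k ^ 3 \<Rightarrow> 'k" assume "g \<in> reduced_line_diffs"
  then obtain f where f: "f \<in> fn.span line_diffs" "g = (\<lambda>u. of_int (f u))"
    unfolding reduced_line_diffs_def by blast
  obtain z where "c = of_int z" using of_int_surj_prime_CARD[OF p] by metis
  then have "(\<lambda>x. c * g x) = (\<lambda>u. of_int (z * f u))" by (simp add: f)
  then show "(\<lambda>x. c * g x) \<in> reduced_line_diffs"
    using reduced_line_diffsI[OF fn.span_scale[OF f(1), of z]] by simp
qed

section \<open>Monomials of low degree modulo p\<close>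

text \<open>The lines with direction (-a, -b, 1) are the common fibres of the linear forms x + a z
  and y + b z.\<close>

lemma mem_line_iff_equations:
  "u \<in> line (vector [s, t, 0]) (vector [-a, -b, 1]) \<longleftrightarrow> u$1 + a * u$3 = s \<and> u$2 + b * u$3 = t"
  for u :: "'k::field ^ 3"
proof
  assume "u \<in> line (vector [s, t, 0]) (vector [-a, -b, 1])"
  then obtain c where "u = vector [s, t, 0] + c *s vector [-a, -b, 1]" unfolding line_def by blast
  then show "u$1 + a * u$3 = s \<and> u$2 + b * u$3 = t" by simp
next
  assume "u$1 + a * u$3 = s \<and> u$2 + b * u$3 = t"
  then have "u = vector [s, t, 0] + (u$3) *s vector [-a, -b, 1]" by (auto simp: vec3_eq_iff)
  then show "u \<in> line (vector [s, t, 0]) (vector [-a, -b, 1])" unfolding line_def by blast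
qed

text \<open>A power product of two linear forms is constant on the lines of a parallel class, so it is a
  combination of these lines; the coefficients add up to zero unless both exponents are maximal.\<close>

lemma linear_form_product_mem:
  fixes a b :: "'k::field"
  assumes p: "prime CARD('k)" and ij: "i < CARD('k)" "j < CARD('k)" "i + j < 2 * (CARD('k) - 1)"
  shows "(\<lambda>u. (u$1 + a * u$3) ^ i * (u$2 + b * u$3) ^ j) \<in> reduced_line_diffs"
proof -
  have fin: "finite (UNIV :: 'k set)" by (rule finite_prime_CARD[OF p])
  define L where "L s t = line (vector [s, t, 0] :: 'k ^ 3) (vector [-a, -b, 1])" for s t
  let ?d = "\<lambda>s t u. indicator (L s t) u - indicator (L 0 0) u :: int"
  have "vector [-a, -b, 1] \<noteq> (0 :: 'k ^ 3)" by (simp add: vec3_eq_iff)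
  then have d: "?d s t \<in> fn.span line_diffs" for s t
    unfolding L_def by (rule line_diff_mem_span)
  have "(\<Sum>s\<in>UNIV. (\<Sum>t\<in>UNIV. (\<lambda>u. (s ^ i * t ^ j) * of_int (?d s t u)))) \<in> reduced_line_diffs"
  proof (intro fn.subspace_sum fn.subspace_scale subspace_reduced_line_diffs p)
    show "(\<lambda>u. of_int (?d s t u)) \<in> reduced_line_diffs" for s t
      by (rule reduced_line_diffsI[OF d])
  qed
  also have "(\<Sum>s\<in>UNIV. (\<Sum>t\<in>UNIV. (\<lambda>u. (s ^ i * t ^ j) * of_int (?d s t u))))
      = (\<lambda>u. (u$1 + a * u$3) ^ i * (u$2 + b * u$3) ^ j)"
  proof
    fix u :: "'k ^ 3"
    have "(\<Sum>s\<in>UNIV. s ^ i) = (0::'k) \<or> (\<Sum>t\<in>UNIV. t ^ j) = (0::'k)"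
    proof (cases "i < CARD('k) - 1")
      case True
      then show ?thesis using sum_power_less_eq_0[OF p] by blast
    next
      case False
      then have "j < CARD('k) - 1" using ij by linarith
      then show ?thesis using sum_power_less_eq_0[OF p] by blast
    qed
    then have 0: "(\<Sum>s\<in>UNIV. \<Sum>t\<in>UNIV. s ^ i * t ^ j) = (0::'k)"
      by (auto simp flip: sum_product)
    have 1: "(\<Sum>s\<in>UNIV. \<Sum>t\<in>UNIV. (s ^ i * t ^ j) * of_bool (u$1 + a * u$3 = s \<and> u$2 + b * u$3 = t))
        = (u$1 + a * u$3) ^ i * (u$2 + b * u$3) ^ j"
    proof -
      have "(\<Sum>t\<in>UNIV. (s ^ i * t ^ j) * of_bool (u$1 + a * u$3 = s \<and> u$2 + b * u$3 = t))
          = (if u$1 + a * u$3 = s then s ^ i * (u$2 + b * u$3) ^ j else 0)" for s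
        using fin by (auto simp: of_bool_def if_distrib cong: if_cong)
      then show ?thesis using fin by simp
    qed
    \<comment> \<open>Comparing each line with the reference line \<open>L 0 0\<close> costs the sum
      of all coefficients times its indicator, which is zero.\<close>
    have "(\<Sum>s\<in>UNIV. \<Sum>t\<in>UNIV. (s ^ i * t ^ j) * of_int (?d s t u))
        = (\<Sum>s\<in>UNIV. \<Sum>t\<in>UNIV. (s ^ i * t ^ j) * of_bool (u$1 + a * u$3 = s \<and> u$2 + b * u$3 = t))
          - (\<Sum>s\<in>UNIV. \<Sum>t\<in>UNIV. s ^ i * t ^ j) * of_int (indicator (L 0 0) u)"
      unfolding sum_distrib_right sum_subtractf[symmetric]
      by (intro sum.cong refl) (simp add: L_def indicator_def mem_line_iff_equations of_bool_def)
    then show "(\<Sum>s\<in>UNIV. (\<Sum>t\<in>UNIV. (\<lambda>u. (s ^ i * t ^ j) * of_int (?d s t u)))) u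
      = (u$1 + a * u$3) ^ i * (u$2 + b * u$3) ^ j"
      unfolding sum_fun_apply 0 1 by simp
  qed
  finally show ?thesis .
qed

text \<open>The exponent of z is split as \<open>k = r + s\<close>; the monomial is then the
  coefficient of \<open>a ^ r\<close> and \<open>b ^ s\<close> in a product of powers of the two
  linear forms, up to nonzero binomial factors.\<close>

lemma monomial_mem:
  assumes p: "prime CARD('k::field)"
    and "i < CARD('k)" "j < CARD('k)" "k < CARD('k)" "i + j + k < 2 * (CARD('k) - 1)"
  shows "(\<lambda>u :: 'k ^ 3. u$1 ^ i * u$2 ^ j * u$3 ^ k) \<in> reduced_line_diffs"
proof -
  \<comment> \<open>As much of \<open>k\<close> as possible goes to the first form, up to exponent p
    - 1; the degree bound keeps the second exponent below p.\<close>
  define r where "r = min k (CARD('k) - 1 - i)"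
  define s where "s = k - r"
  have rs: "i + r < CARD('k)" "j + s < CARD('k)" "r + s = k" "i + r + (j + s) < 2 * (CARD('k) - 1)"
    using assms(2-) by (auto simp: r_def s_def min_def)
  note sub = subspace_reduced_line_diffs[OF p]
  have "(\<lambda>u :: 'k ^ 3. (u$2 + b * u$3) ^ (j + s) * (u$1 + a * u$3) ^ (i + r)) \<in> reduced_line_diffs" for a b
    using linear_form_product_mem[OF p rs(1,2,4)] by (simp add: mult.commute)
  then have "(\<lambda>u :: 'k ^ 3. (u$2 + b * u$3) ^ (j + s) * (u$1 ^ (i + r - r) * u$3 ^ r)) \<in> reduced_line_diffs" for b
    by (intro subspace_binomial_coeff[OF p sub rs(1)]) auto
  then have "(\<lambda>u :: 'k ^ 3. (u$1 ^ i * u$3 ^ r) * (u$2 + b * u$3) ^ (j + s)) \<in> reduced_line_diffs" for b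
    by (simp add: mult.commute)
  then have "(\<lambda>u :: 'k ^ 3. (u$1 ^ i * u$3 ^ r) * (u$2 ^ (j + s - s) * u$3 ^ s)) \<in> reduced_line_diffs"
    by (intro subspace_binomial_coeff[OF p sub rs(2)]) auto
  then show ?thesis by (simp add: mult_ac flip: rs(3) power_add)
qed

subsection \<open>Sets meeting every plane in a multiple of p points\<close>

lemma subspace_sum_eq_0: "fn.subspace {g. (\<Sum>u\<in>S. g u) = 0}"
  by (rule fn.subspaceI) (auto simp: sum.distrib simp flip: sum_distrib_left)

text \<open>Modulo p, a plane section is counted by summing 1 minus a (p - 1)-st power. The
  functions with sum zero over \<open>S\<close> form a subspace, so the coefficients in
  \<open>c\<close>, \<open>b\<close> and \<open>a\<close> can be extracted in turn.\<close>

lemma p_divisible_sum_monomial: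
  fixes S :: "('k::field ^ 3) set"
  assumes p: "prime CARD('k)" and S: "p_divisible CARD('k) S" "CARD('k) dvd card S"
    and ijk: "i + j + k < CARD('k)"
  shows "(\<Sum>u\<in>S. u$1 ^ i * u$2 ^ j * u$3 ^ k) = 0"
proof -
  let ?q = "CARD('k) - 1"
  let ?V = "{g :: 'k ^ 3 \<Rightarrow> 'k. (\<Sum>u\<in>S. g u) = 0}"
  have fin: "finite S"
    using finite_UNIV_vec[OF finite_prime_CARD[OF p]] by (rule finite_subset[OF subset_UNIV])
  have of_nat_0: "(of_nat n :: 'k) = 0" if "CARD('k) dvd n" for n
    using of_int_eq_0_iff_prime_CARD[OF p, of "int n"] that by simp
  have q: "?q < CARD('k)" by (rule diff_less[OF zero_less_one prime_gt_0_nat[OF p]])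
  have 1: "(\<lambda>u. 1 * ((u$1 + a * u$2 + b * u$3) + c * 1) ^ ?q) \<in> ?V" for a b c
  proof -
    define H where "H = {u :: 'k ^ 3. u$1 + a * u$2 + b * u$3 + c = 0}"
    have "is_plane H" unfolding H_def by (rule is_plane_equation)
    then have "[card (S \<inter> H) = 0] (mod CARD('k))" using S(1) unfolding p_divisible_def by blast
    then have "CARD('k) dvd card (S \<inter> H)" by (simp only: cong_0_iff)
    then have "0 = (of_nat (card (S \<inter> H)) :: 'k)" using of_nat_0 by simp
    also have "\<dots> = (\<Sum>u\<in>S. if u$1 + a * u$2 + b * u$3 + c = 0 then 1 else 0)"
      using fin by (simp add: sum.If_cases H_def Int_def)
    also have "\<dots> = (\<Sum>u\<in>S. 1 - (u$1 + a * u$2 + b * u$3 + c) ^ ?q)"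
      by (simp only: indicator_eq_power[OF p])
    also have "\<dots> = - (\<Sum>u\<in>S. (u$1 + a * u$2 + b * u$3 + c) ^ ?q)"
      using of_nat_0[OF S(2)] by (simp add: sum_subtractf)
    finally show ?thesis by simp
  qed
  \<comment> \<open>Taking the coefficient of \<open>c ^ (p - 1 - (i + j + k))\<close> lowers the
    degree of the remaining form to \<open>i + j + k\<close>.\<close>
  have "(\<lambda>u. 1 * ((u$1 + a * u$2 + b * u$3) ^ (?q - (?q - (i + j + k))) * 1 ^ (?q - (i + j + k)))) \<in> ?V" for a b
    by (rule subspace_binomial_coeff[OF p subspace_sum_eq_0 q]) (use 1 in auto)
  moreover have "?q - (?q - (i + j + k)) = i + j + k" using ijk by simp
  ultimately have 2: "(\<lambda>u. 1 * ((u$1 + a * u$2) + b * u$3) ^ (i + j + k)) \<in> ?V" for a b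
    by simp
  have "(\<lambda>u. 1 * ((u$1 + a * u$2) ^ (i + j + k - k) * u$3 ^ k)) \<in> ?V" for a
    by (rule subspace_binomial_coeff[OF p subspace_sum_eq_0 ijk]) (use 2 in auto)
  then have 3: "(\<lambda>u. u$3 ^ k * (u$1 + a * u$2) ^ (i + j)) \<in> ?V" for a
    by (simp add: mult.commute)
  have "(\<lambda>u. u$3 ^ k * (u$1 ^ (i + j - j) * u$2 ^ j)) \<in> ?V"
    by (rule subspace_binomial_coeff[OF p subspace_sum_eq_0]) (use 3 ijk in auto)
  then show ?thesis by (simp add: mult_ac)
qed

text \<open>The coefficient of \<open>x\<^sup>i\<close> in \<open>1 - (x - u)\<^sup>p\<^sup>-\<^sup>1\<close>, which is the indicator of \<open>u\<close>.\<close>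

definition delta_coeff :: "nat \<Rightarrow> 'k::field \<Rightarrow> 'k" where
  "delta_coeff i u = of_bool (i = 0) -
     of_nat ((CARD('k) - 1) choose i) * (-1) ^ (CARD('k) - 1 - i) * u ^ (CARD('k) - 1 - i)"

lemma delta_expansion:
  assumes p: "prime CARD('k::field)"
  shows "of_bool (x = u) = (\<Sum>i<CARD('k). (x::'k) ^ i * delta_coeff i u)"
proof -
  let ?q = "CARD('k) - 1"
  have q: "{..<CARD('k)} = {..?q}" using prime_gt_0_nat[OF p] by auto
  have "of_bool (x = u) = 1 - (x + - u) ^ ?q"
    using indicator_eq_power[OF p, of "x - u"] by (auto simp: of_bool_def)
  also have "\<dots> = 1 - (\<Sum>i\<le>?q. of_nat (?q choose i) * x ^ i * (- u) ^ (?q - i))"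
    by (simp only: binomial_ring)
  also have "1 = (\<Sum>i\<le>?q. x ^ i * of_bool (i = 0))"
    by (simp add: of_bool_def if_distrib cong: if_cong)
  finally show ?thesis
    unfolding q delta_coeff_def sum_subtractf[symmetric]
    by (simp add: right_diff_distrib mult_ac power_minus[of u] cong: if_cong)
qed

text \<open>In its field argument, \<open>delta_coeff i\<close> is a combination of the constant 1
  and the power with exponent p - 1 - i.\<close>

lemma delta_coeff_mem_subspace:
  fixes A :: "'b \<Rightarrow> 'k::field"
  assumes V: "fn.subspace V" and "g \<in> V" "(\<lambda>u. g u * A u ^ (CARD('k) - 1 - i)) \<in> V"
  shows "(\<lambda>u. g u * delta_coeff i (A u)) \<in> V"
proof -
  let ?c = "of_nat ((CARD('k) - 1) choose i) * (-1) ^ (CARD('k) - 1 - i) :: 'k"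
  have "(\<lambda>u. of_bool (i = 0) * g u) - (\<lambda>u. ?c * (g u * A u ^ (CARD('k) - 1 - i))) \<in> V"
    by (intro fn.subspace_diff fn.subspace_scale V assms)
  also have "(\<lambda>u. of_bool (i = 0) * g u) - (\<lambda>u. ?c * (g u * A u ^ (CARD('k) - 1 - i)))
      = (\<lambda>u. g u * delta_coeff i (A u))"
    by (simp add: fun_eq_iff delta_coeff_def algebra_simps)
  finally show ?thesis .
qed

text \<open>As a polynomial in \<open>u\<close>, the product has degree at most 3 (p - 1) - (i + j +
  k), hence at most p - 1, and all such monomials sum to zero over \<open>S\<close>. The coordinates
  are treated one at a time.\<close>

lemma p_divisible_sum_delta_coeff:
  fixes S :: "('k::field ^ 3) set"
  assumes p: "prime CARD('k)" and S: "p_divisible CARD('k) S" "CARD('k) dvd card S"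
    and ijk: "i < CARD('k)" "j < CARD('k)" "k < CARD('k)" "2 * (CARD('k) - 1) \<le> i + j + k"
  shows "(\<Sum>u\<in>S. delta_coeff i (u$1) * delta_coeff j (u$2) * delta_coeff k (u$3)) = 0"
proof -
  let ?q = "CARD('k) - 1"
  let ?V = "{g :: 'k ^ 3 \<Rightarrow> 'k. (\<Sum>u\<in>S. g u) = 0}"
  note step = delta_coeff_mem_subspace[OF subspace_sum_eq_0]
  have mono: "(\<lambda>u. u$1 ^ e * u$2 ^ f * u$3 ^ h) \<in> ?V" if "e \<le> ?q - i" "f \<le> ?q - j" "h \<le> ?q - k" for e f h
  proof -
    have "e + f + h < CARD('k)" using that ijk by linarith
    then show ?thesis using p_divisible_sum_monomial[OF p S] by simp
  qed
  have "(\<lambda>u. (u$1 ^ e * u$2 ^ f) * delta_coeff k (u$3)) \<in> ?V" if "e \<le> ?q - i" "f \<le> ?q - j" for e f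
    by (rule step) (use mono[OF that, of 0] mono[OF that, of "?q - k"] in simp_all)
  then have 2: "(\<lambda>u. (u$1 ^ e * delta_coeff k (u$3)) * u$2 ^ f) \<in> ?V" if "e \<le> ?q - i" "f \<le> ?q - j" for e f
    using that by (simp add: mult_ac)
  have "(\<lambda>u. (u$1 ^ e * delta_coeff k (u$3)) * delta_coeff j (u$2)) \<in> ?V" if "e \<le> ?q - i" for e
    by (rule step) (use 2[OF that, of 0] 2[OF that, of "?q - j"] in simp_all)
  then have 3: "(\<lambda>u. (delta_coeff k (u$3) * delta_coeff j (u$2)) * u$1 ^ e) \<in> ?V" if "e \<le> ?q - i" for e
    using that by (simp add: mult_ac)
  have "(\<lambda>u. (delta_coeff k (u$3) * delta_coeff j (u$2)) * delta_coeff i (u$1)) \<in> ?V"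
    by (rule step) (use 3[of 0] 3[of "?q - i"] in simp_all)
  then show ?thesis by (simp add: mult_ac)
qed

lemma sum_product3:
  fixes f g h :: "'i \<Rightarrow> 'a::comm_semiring_0"
  shows "(\<Sum>i\<in>A. f i) * (\<Sum>j\<in>B. g j) * (\<Sum>k\<in>C. h k) = (\<Sum>i\<in>A. \<Sum>j\<in>B. \<Sum>k\<in>C. f i * g j * h k)"
  by (subst sum_product, simp only: sum_distrib_right, simp only: sum_distrib_left)

text \<open>Expanding each point of \<open>S\<close> by \<open>delta_expansion\<close> gives the
  reduced polynomial of the indicator. Its coefficients vanish from degree 2 (p - 1) on, and the
  monomials of lower degree lie in the reduced span.\<close>

lemma p_divisible_indicator_mem:
  fixes S :: "('k::field ^ 3) set"
  assumes p: "prime CARD('k)" and S: "p_divisible CARD('k) S" "CARD('k) dvd card S"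
  shows "(\<lambda>x. of_int (indicator S x)) \<in> reduced_line_diffs"
proof -
  let ?p = "CARD('k)"
  have fin: "finite S"
    using finite_UNIV_vec[OF finite_prime_CARD[OF p]] by (rule finite_subset[OF subset_UNIV])
  define C where "C i j k = (\<Sum>u\<in>S. delta_coeff i (u$1) * delta_coeff j (u$2) * delta_coeff k (u$3))"
    for i j k
  have "(\<lambda>x. C i j k * (x$1 ^ i * x$2 ^ j * x$3 ^ k)) \<in> reduced_line_diffs"
    if "i < ?p" "j < ?p" "k < ?p" for i j k
  proof (cases "i + j + k < 2 * (?p - 1)")
    case True
    then show ?thesis
      by (intro fn.subspace_scale subspace_reduced_line_diffs monomial_mem p that)
  next
    case False
    then have "C i j k = 0"
      unfolding C_def using that by (intro p_divisible_sum_delta_coeff p S) auto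
    then show ?thesis
      using fn.subspace_0[OF subspace_reduced_line_diffs[OF p]] by (simp add: zero_fun_def)
  qed
  then have "(\<Sum>i<?p. \<Sum>j<?p. \<Sum>k<?p. (\<lambda>x. C i j k * (x$1 ^ i * x$2 ^ j * x$3 ^ k))) \<in> reduced_line_diffs"
    by (intro fn.subspace_sum subspace_reduced_line_diffs p) auto
  also have "(\<Sum>i<?p. \<Sum>j<?p. \<Sum>k<?p. (\<lambda>x. C i j k * (x$1 ^ i * x$2 ^ j * x$3 ^ k)))
      = (\<lambda>x. of_int (indicator S x))"
  proof
    fix x :: "'k ^ 3"
    let ?t = "\<lambda>i j k u. (x$1 ^ i * delta_coeff i (u$1)) * (x$2 ^ j * delta_coeff j (u$2)) * (x$3 ^ k * delta_coeff k (u$3))"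
    have "of_int (indicator S x) = (\<Sum>u\<in>S. of_bool (x = u))"
      using fin by (simp add: indicator_def of_bool_def)
    also have "\<dots> = (\<Sum>u\<in>S. of_bool (x$1 = u$1) * of_bool (x$2 = u$2) * of_bool (x$3 = u$3))"
      by (intro sum.cong refl) (simp add: vec3_eq_iff[of x])
    also have "\<dots> = (\<Sum>u\<in>S. \<Sum>i<?p. \<Sum>j<?p. \<Sum>k<?p. ?t i j k u)"
      by (simp only: delta_expansion[OF p] sum_product3)
    also have "\<dots> = (\<Sum>i<?p. \<Sum>j<?p. \<Sum>k<?p. \<Sum>u\<in>S. ?t i j k u)"
      by ((subst sum.swap, intro sum.cong refl)+)
    also have "\<dots> = (\<Sum>i<?p. \<Sum>j<?p. \<Sum>k<?p. C i j k * (x$1 ^ i * x$2 ^ j * x$3 ^ k))"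
      unfolding C_def sum_distrib_right by (simp only: mult_ac)
    finally show "(\<Sum>i<?p. \<Sum>j<?p. \<Sum>k<?p. (\<lambda>x. C i j k * (x$1 ^ i * x$2 ^ j * x$3 ^ k))) x
        = of_int (indicator S x)"
      unfolding sum_fun_apply by simp
  qed
  finally show ?thesis .
qed

subsection \<open>Cylinders\<close>

lemma is_cylinder_Union_lines:
  assumes "v \<noteq> (0 :: 'k::field ^ 3)" "L \<subseteq> range (\<lambda>x. line x v)" "card L = CARD('k)"
  shows "is_cylinder (\<Union>L)"
proof -
  have "is_line l" if "l \<in> L" for l using that assms(1,2) is_line_line by blast
  moreover have "parallel_lines l1 l2" if "l1 \<in> L" "l2 \<in> L" for l1 l2
    using that assms(1,2) unfolding parallel_lines_iff by blast
  moreover have "pairwise disjnt L"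
  proof (rule pairwiseI)
    fix l1 l2 assume "l1 \<in> L" "l2 \<in> L" "l1 \<noteq> l2"
    then show "disjnt l1 l2" using assms(2) line_disjoint_or_eq by blast
  qed
  ultimately show ?thesis unfolding is_cylinder_def using assms(3) by blast
qed

text \<open>The lines with direction \<open>v\<close> partition the p^3 points into classes of p
  points.\<close>

lemma card_parallel_class:
  assumes p: "prime CARD('k::field)" and v: "v \<noteq> (0 :: 'k ^ 3)"
  shows "card (range (\<lambda>x. line x v)) = CARD('k) ^ 2"
proof -
  have fin: "finite (UNIV :: ('k ^ 3) set)"
    by (rule finite_UNIV_vec) (rule finite_prime_CARD[OF p])
  have "CARD('k) * card (range (\<lambda>x. line x v)) = card (\<Union>(range (\<lambda>x. line x v)))"
  proof (rule card_partition)
    show "finite (range (\<lambda>x. line x v))" using fin by (rule finite_imageI)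
    show "finite (\<Union>(range (\<lambda>x. line x v)))" using fin by (rule finite_subset[OF subset_UNIV])
    show "card l = CARD('k)" if "l \<in> range (\<lambda>x. line x v)" for l
      using that card_line[OF v] by blast
    show "l1 \<inter> l2 = {}"
      if "l1 \<in> range (\<lambda>x. line x v)" "l2 \<in> range (\<lambda>x. line x v)" "l1 \<noteq> l2" for l1 l2
      using that line_disjoint_or_eq unfolding disjnt_def by blast
  qed
  also have "\<Union>(range (\<lambda>x. line x v)) = UNIV" using mem_line_self by blast
  also have "card (UNIV :: ('k ^ 3) set) = CARD('k) * CARD('k) ^ 2"
    by (simp add: power2_eq_square power3_eq_cube)
  finally show ?thesis
    using prime_gt_0_nat[OF p] by (metis mult_left_cancel less_not_refl)
qed

text \<open>Two distinct parallel lines can be completed to cylinders by the same \<open>p - 1\<close> further lines.\<close>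

lemma line_diffs_subset_span_cylinders:
  assumes p: "prime CARD('k::field)"
  shows "(line_diffs :: ('k ^ 3 \<Rightarrow> int) set) \<subseteq> fn.span {indicator C | C. is_cylinder C}"
proof
  fix f :: "'k ^ 3 \<Rightarrow> int" assume "f \<in> line_diffs"
  then obtain x y v where f: "f = (\<lambda>z. indicator (line x v) z - indicator (line y v) z)" and v: "v \<noteq> 0"
    unfolding line_diffs_eq by blast
  let ?P = "range (\<lambda>x. line x v)"
  show "f \<in> fn.span {indicator C | C. is_cylinder C}"
  proof (cases "line x v = line y v")
    case True
    then have "f = 0" by (simp add: f fun_eq_iff)
    then show ?thesis by (simp only: fn.span_zero)
  next
    case False
    have fin: "finite ?P"
      using finite_UNIV_vec[OF finite_prime_CARD[OF p]] by (rule finite_imageI)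
    \<comment> \<open>The parallel class has p^2 - 2 lines besides the two given ones, which leaves
      room for p - 1 common lines.\<close>
    have "n - 1 \<le> n ^ 2 - 2" if n: "2 \<le> n" for n :: nat
    proof -
      obtain m where "n = 2 + m" using le_Suc_ex[OF n] by blast
      then show ?thesis by (simp add: power2_eq_square)
    qed
    then have "CARD('k) - 1 \<le> CARD('k) ^ 2 - 2"
      using prime_ge_2_nat[OF p] by blast
    also have "\<dots> = card (?P - {line x v, line y v})"
      using False card_parallel_class[OF p v] by (subst card_Diff_subset) auto
    finally obtain L where L: "L \<subseteq> ?P - {line x v, line y v}" "card L = CARD('k) - 1" "finite L"
      by (rule obtain_subset_with_card_n)
    have cyl: "is_cylinder (\<Union>(insert l L))" if "l \<in> {line x v, line y v}" for l
    proof (rule is_cylinder_Union_lines[OF v])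
      show "insert l L \<subseteq> ?P" using that L(1) by blast
      have "l \<notin> L" using that L(1) by blast
      then show "card (insert l L) = CARD('k)"
        using L(2,3) prime_gt_0_nat[OF p] by simp
    qed
    have ind: "indicator (l \<union> \<Union>L) z = indicator l z + (indicator (\<Union>L) z :: int)"
      if "l \<in> {line x v, line y v}" for l z
    proof -
      have "disjnt l l'" if "l' \<in> L" for l'
        using that \<open>l \<in> {line x v, line y v}\<close> L(1) line_disjoint_or_eq by blast
      then have "l \<inter> \<Union>L = {}" unfolding disjnt_def by blast
      then show ?thesis by (auto simp: indicator_def)
    qed
    have "indicator (\<Union>(insert (line x v) L)) - indicator (\<Union>(insert (line y v) L))
        \<in> fn.span {indicator C | C. is_cylinder C}"
      using cyl by (intro fn.span_diff fn.span_base) blast+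
    also have "indicator (\<Union>(insert (line x v) L)) - indicator (\<Union>(insert (line y v) L)) = f"
      by (rule ext) (simp add: f ind)
    finally show ?thesis .
  qed
qed

section \<open>The reference plane and the comparison with it\<close>

lemma is_cylinder_coordinate_plane:
  assumes "finite (UNIV :: 'k::field set)"
  shows "is_cylinder {x :: 'k ^ 3. x$1 = 0}"
proof -
  let ?v = "vector [0, 0, 1] :: 'k ^ 3"
  let ?l = "\<lambda>s. line (vector [0, s, 0]) ?v"
  have mem: "x \<in> ?l s \<longleftrightarrow> x$1 = 0 \<and> x$2 = s" for x s
    using mem_line_iff_equations[of x 0 s 0 0] by simp
  have "inj ?l"
  proof (rule injI)
    fix s t assume "?l s = ?l t"
    then have "vector [0, s, 0] \<in> ?l t" by (metis mem_line_self)
    then show "s = t" by (simp add: mem)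
  qed
  then have "card (range ?l) = CARD('k)" by (rule card_image)
  moreover have "?v \<noteq> 0" by (simp add: vec3_eq_iff)
  ultimately have "is_cylinder (\<Union>(range ?l))"
    by (intro is_cylinder_Union_lines[of ?v]) auto
  also have "\<Union>(range ?l) = {x :: 'k ^ 3. x$1 = 0}" using mem by auto
  finally show ?thesis .
qed

lemma card_coordinate_plane: "card {x :: 'k::field ^ 3. x$1 = 0} = CARD('k) ^ 2"
proof -
  have "bij_betw (\<lambda>(s, t). vector [0, s, t]) (UNIV \<times> UNIV) {x :: 'k ^ 3. x$1 = 0}"
    by (rule bij_betwI[of _ _ _ "\<lambda>x. (x$2, x$3)"]) (auto simp: vec3_eq_iff)
  then have "card {x :: 'k ^ 3. x$1 = 0} = card (UNIV \<times> UNIV :: ('k \<times> 'k) set)"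
    by (rule bij_betw_same_card[symmetric])
  then show ?thesis by (simp add: card_cartesian_product power2_eq_square)
qed

text \<open>Modulo p the indicator is 1 - x^(p - 1), whose monomials have degree below 2 (p -
  1).\<close>

lemma coordinate_plane_indicator_mem:
  assumes p: "prime CARD('k::field)"
  shows "(\<lambda>x :: 'k ^ 3. of_int (indicator {x. x$1 = 0} x)) \<in> reduced_line_diffs"
proof -
  note sub = subspace_reduced_line_diffs[OF p]
  have "(\<lambda>x :: 'k ^ 3. x$1 ^ 0 * x$2 ^ 0 * x$3 ^ 0) - (\<lambda>x. x$1 ^ (CARD('k) - 1) * x$2 ^ 0 * x$3 ^ 0)
      \<in> reduced_line_diffs"
    by (intro fn.subspace_diff sub monomial_mem p) (use prime_gt_1_nat[OF p] in linarith)+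
  also have "(\<lambda>x :: 'k ^ 3. x$1 ^ 0 * x$2 ^ 0 * x$3 ^ 0) - (\<lambda>x. x$1 ^ (CARD('k) - 1) * x$2 ^ 0 * x$3 ^ 0)
      = (\<lambda>x. of_int (indicator {x. x$1 = 0} x))"
    by (rule ext) (simp add: indicator_def indicator_eq_power[OF p, symmetric] del: One_nat_def)
  finally show ?thesis .
qed

text \<open>Both indicators lie in the span modulo p, so their difference is \<open>m\<close> plus p
  times some \<open>g\<close>. The two sets are equally large and \<open>m\<close> sums to zero,
  hence so does \<open>g\<close>, and its p-fold lies in the span.\<close>

lemma p_divisible_minus_plane_mem:
  fixes S :: "('k::field ^ 3) set"
  assumes p: "prime CARD('k)" and S: "p_divisible CARD('k) S" "card S = CARD('k) ^ 2"
  shows "(\<lambda>x. indicator S x - indicator {x. x$1 = 0} x) \<in> fn.span line_diffs"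
proof -
  let ?H = "{x :: 'k ^ 3. x$1 = 0}"
  have fin: "finite (UNIV :: 'k set)" by (rule finite_prime_CARD[OF p])
  have fin3: "finite (UNIV :: ('k ^ 3) set)" by (rule finite_UNIV_vec[OF fin])
  have "CARD('k) dvd card S" by (simp add: S(2))
  then have "(\<lambda>x. of_int (indicator S x)) \<in> (reduced_line_diffs :: ('k ^ 3 \<Rightarrow> 'k) set)"
    by (rule p_divisible_indicator_mem[OF p S(1)])
  from fn.subspace_diff[OF subspace_reduced_line_diffs[OF p] this coordinate_plane_indicator_mem[OF p]]
  obtain m where m: "m \<in> fn.span line_diffs"
      "(\<lambda>x. of_int (indicator S x)) - (\<lambda>x. of_int (indicator ?H x)) = (\<lambda>x. of_int (m x) :: 'k)"
    unfolding reduced_line_diffs_def by blast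
  define h where "h x = indicator S x - indicator ?H x - m x" for x
  define g where "g x = h x div int CARD('k)" for x
  have "int CARD('k) dvd h x" for x
  proof -
    have "(of_int (h x) :: 'k) = 0"
      using fun_cong[OF m(2), of x] by (simp add: h_def)
    then show ?thesis by (simp only: of_int_eq_0_iff_prime_CARD[OF p])
  qed
  then have hg: "h x = int CARD('k) * g x" for x by (simp add: g_def)
  have "int CARD('k) * (\<Sum>x\<in>UNIV. g x) = (\<Sum>x\<in>UNIV. h x)"
    by (simp only: hg sum_distrib_left)
  also have "\<dots> = 0"
    unfolding h_def sum_subtractf sum_UNIV_indicator[OF fin3] sum_line_diff_span[OF fin m(1)]
    by (simp only: S(2) card_coordinate_plane)
  finally have "(\<Sum>x\<in>UNIV. g x) = 0"
    using prime_gt_0_nat[OF p] by (metis mult_eq_0_iff of_nat_eq_0_iff less_not_refl)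
  then have "(\<lambda>x. int CARD('k) * g x) \<in> fn.span line_diffs"
    by (rule CARD_multiple_mem_span[OF fin])
  then have "m + (\<lambda>x. int CARD('k) * g x) \<in> fn.span line_diffs"
    by (rule fn.span_add[OF m(1)])
  also have "m + (\<lambda>x. int CARD('k) * g x) = (\<lambda>x. indicator S x - indicator ?H x)"
    by (rule ext) (simp flip: hg add: h_def)
  finally show ?thesis .
qed

theorem theorem1p12:
  fixes p :: nat and S :: "('k::field ^ 3) set"
  assumes "prime p" and "CARD('k) = p"
    and "card S = p ^ 2" and "p_divisible p S"
  shows "indicator S \<in> int_span {indicator C | C :: ('k ^ 3) set. is_cylinder C} \<and>
    (\<exists>H f. is_plane H \<and>
       f \<in> int_span {(\<lambda>x. indicator l1 x - indicator l2 x) | l1 l2 :: ('k ^ 3) set.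
                       is_line l1 \<and> is_line l2 \<and> parallel_lines l1 l2} \<and>
       indicator S = (\<lambda>x. indicator H x + f x))"
proof -
  let ?H = "{x :: 'k ^ 3. x$1 = 0}"
  let ?f = "\<lambda>x :: 'k ^ 3. indicator S x - indicator ?H x :: int"
  let ?cyl = "{indicator C | C :: ('k ^ 3) set. is_cylinder C} :: ('k ^ 3 \<Rightarrow> int) set"
  have p: "prime CARD('k)" using assms(1,2) by simp
  have f: "?f \<in> fn.span line_diffs"
    using p_divisible_minus_plane_mem[OF p] assms(2-4) by simp
  \<comment> \<open>The cylinder form follows from the plane form: the plane is a cylinder, and each
    difference of parallel lines is a combination of cylinders.\<close>
  have "fn.span line_diffs \<subseteq> fn.span ?cyl"
    by (rule fn.span_minimal[OF line_diffs_subset_span_cylinders[OF p] fn.subspace_span])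
  then have "?f \<in> fn.span ?cyl" using f by blast
  moreover have "indicator ?H \<in> fn.span ?cyl"
    by (rule fn.span_base) (use is_cylinder_coordinate_plane[OF finite_prime_CARD[OF p]] in blast)
  ultimately have "indicator ?H + ?f \<in> fn.span ?cyl" by (intro fn.span_add)
  moreover have "indicator ?H + ?f = indicator S" by (rule ext) simp
  ultimately have 1: "indicator S \<in> int_span ?cyl" by (simp only: int_span_eq_span)
  have "is_plane ?H" using is_plane_equation[of 0 0 0] by simp
  moreover have "?f \<in> int_span line_diffs" using f by (simp only: int_span_eq_span)
  moreover have "indicator S = (\<lambda>x. indicator ?H x + ?f x)" by (rule ext) simp
  ultimately show ?thesis using 1 unfolding line_diffs_def by blast
qed

end
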